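(* Let $G_1,\ldots,G_n$ be nondeterministic automata, where $G_i$ has set of secret states $Q_i^S$, and consider the composed system $G_1\|\cdots\|G_n$ with interaction $\|_\lor$, i.e. with set of secret states $Q^S=Q\setminus(Q_1^{NS}\times\cdots\times Q_n^{NS})$, $Q_i^{NS}=Q_i\setminus Q_i^S$. Let $det(G_i)=\langle\Sigma_i,X^i_{obs},\to_i,X_i^\circ\rangle$ be the current-state estimator of $G_i$, and let $det(G_i)_{\psi_i}$ be its $\psi_i$-automaton with set of $\psi_i$-states $X^i_{\psi_i}=\{X\in X^i_{obs}: X\subseteq Q_i^S\}$, where $\psi_1,\ldots,\psi_n$ are pairwise distinct new events. Then $G_1\|\cdots\|G_n$ is not current-state opaque if and only if $det(G_1)_{\psi_1}\|\cdots\|det(G_n)_{\psi_n}$ is blocking.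
   Context: An automaton is $G=\langle\Sigma_\tau,Q,\to,Q^\circ\rangle$ with finite set $\Sigma$ of observable events, a special unobservable event $\tau\notin\Sigma$, $\Sigma_\tau=\Sigma\cup\{\tau\}$, finite states $Q$, transitions $\to\subseteq Q\times\Sigma_\tau\times Q$, initial states $Q^\circ$, possibly marked states $Q^m$; it carries a set of secret states $Q^S$. For $s\in\Sigma^*$, $p\stackrel{s}{\Rightarrow}q$ means there is $t\in\Sigma_\tau^*$ which becomes $s$ after deleting all $\tau$'s and $p\stackrel{t}{\to}q$; $L(G,q)=\{s: q\stackrel{s}{\Rightarrow}q'\text{ for some }q'\}$. Synchronous composition: states are tuples, initial (resp. marked) states are products of initial (resp. marked) states; an event (other than $\tau$) shared by components is executed jointly by all components having it in their alphabet; other events (including $\tau$) are executed by a single component while the others stay put. Current-state opacity: $G$ is current-state opaque w.r.t. $Q^S$ iff for every $q^\circ\in Q^\circ$ and every $s\in L(G,q^\circ)$ with $q^\circ\stackrel{s}{\Rightarrow}Q^S$ there is $q'^\circ\in Q^\circ$ with $q'^\circ\stackrel{s}{\Rightarrow}Q\setminus Q^S$. Current-state estimator: $UR(B)$ is the set of states reachable from $B\subseteq Q$ by strings in $\{\tau\}^*$; $det(G)$ is the deterministic automaton over $\Sigma$ with initial state $UR(Q^\circ)$ and transitions $X\stackrel{\sigma}{\to}Y$ where $Y=\bigcup\{UR(\{y\}):x\stackrel{\sigma}{\to}y,x\in X\}$ is nonempty; its state set $X_{obs}\subseteq 2^Q$ consists of the reachable states. $\psi$-automaton: for a deterministic automaton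 $D=\langle\Sigma,Q_D,\to,q^\circ\rangle$, a set $X_\psi\subseteq Q_D$ of $\psi$-states and a new event $\psi\notin\Sigma$, $D_\psi=\langle\Sigma\cup\{\psi\},Q_D\cup\{\bot\},\to\cup\{(x,\psi,\bot):x\in X_\psi\},q^\circ,Q_D\rangle$, where $\bot$ is a new state and all original states (but not $\bot$) are marked. An automaton is blocking if some state reachable from an initial state has no path to a marked state; otherwise it is nonblocking.
   Formalization: Each G_i is assumed to have at least one initial state; if some Q_i° is empty, the composed system is vacuously opaque while det(G_i) starts in the empty set, a ψ_i-state, so the composition is blocking and the stated equivalence fails. *)

theory Defs
  imports Main "HOL-Library.FuncSet"
begin

text \<open>Labels have type \<open>'e option\<close>: \<open>Some \<sigma>\<close> is an observable event and \<open>None\<close> is the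
  unobservable event \<open>\<tau>\<close>, so that \<open>\<tau>\<close> lies outside \<open>alphabet G\<close> by construction.\<close>

record ('q, 'e) automaton =
  alphabet :: "'e set"
  states :: "'q set"
  transitions :: "('q \<times> 'e option \<times> 'q) set"
  initial :: "'q set"

record ('q, 'e) marked_automaton = "('q, 'e) automaton" +
  marked :: "'q set"

definition wf_automaton :: "('q, 'e, 'm) automaton_scheme \<Rightarrow> bool" where
  "wf_automaton G \<longleftrightarrow>
     finite (alphabet G) \<and> finite (states G) \<and>
     transitions G \<subseteq> states G \<times> (insert None (Some ` alphabet G)) \<times> states G \<and>
     initial G \<subseteq> states G"

fun run :: "('q, 'e, 'm) automaton_scheme \<Rightarrow> 'q \<Rightarrow> 'e option list \<Rightarrow> 'q \<Rightarrow> bool" where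
  "run G p [] q \<longleftrightarrow> p = q"
| "run G p (a # t) q \<longleftrightarrow> (\<exists>r. (p, a, r) \<in> transitions G \<and> run G r t q)"

definition erase_tau :: "'e option list \<Rightarrow> 'e list" where
  "erase_tau t = map the (filter (\<lambda>a. a \<noteq> None) t)"

definition weak_run :: "('q, 'e, 'm) automaton_scheme \<Rightarrow> 'q \<Rightarrow> 'e list \<Rightarrow> 'q \<Rightarrow> bool" where
  "weak_run G p s q \<longleftrightarrow> (\<exists>t. erase_tau t = s \<and> run G p t q)"

definition lang :: "('q, 'e, 'm) automaton_scheme \<Rightarrow> 'q \<Rightarrow> 'e list set" where
  "lang G q = {s. \<exists>q'. weak_run G q s q'}"

definition reachable :: "('q, 'e, 'm) automaton_scheme \<Rightarrow> 'q set" where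
  "reachable G = {q. \<exists>q0\<in>initial G. \<exists>t. run G q0 t q}"

text \<open>Tuples indexed by \<open>I\<close> are extensional functions on \<open>I\<close>. An observable event owned by a
  single component is the special case of a jointly executed event with one participant.\<close>

definition sync :: "'i set \<Rightarrow> ('i \<Rightarrow> ('q, 'e, 'm) automaton_scheme) \<Rightarrow> ('i \<Rightarrow> 'q, 'e) automaton"
  where
  "sync I G =
     \<lparr>alphabet = (\<Union>i\<in>I. alphabet (G i)),
      states = PiE I (\<lambda>i. states (G i)),
      transitions =
        {(x, Some \<sigma>, y) | x \<sigma> y.
           x \<in> PiE I (\<lambda>i. states (G i)) \<and> y \<in> PiE I (\<lambda>i. states (G i)) \<and>
           \<sigma> \<in> (\<Union>i\<in>I. alphabet (G i)) \<and>
           (\<forall>i\<in>I. if \<sigma> \<in> alphabet (G i) then (x i, Some \<sigma>, y i) \<in> transitions (G i)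
                   else y i = x i)} \<union>
        {(x, None, y) | x y.
           x \<in> PiE I (\<lambda>i. states (G i)) \<and> y \<in> PiE I (\<lambda>i. states (G i)) \<and>
           (\<exists>i\<in>I. (x i, None, y i) \<in> transitions (G i) \<and> (\<forall>j\<in>I. j \<noteq> i \<longrightarrow> y j = x j))},
      initial = PiE I (\<lambda>i. initial (G i))\<rparr>"

definition sync_marked ::
  "'i set \<Rightarrow> ('i \<Rightarrow> ('q, 'e) marked_automaton) \<Rightarrow> ('i \<Rightarrow> 'q, 'e) marked_automaton" where
  "sync_marked I G =
     automaton.extend (sync I G) (marked_automaton.fields (PiE I (\<lambda>i. marked (G i))))"

definition or_secret ::
  "'i set \<Rightarrow> ('i \<Rightarrow> ('q, 'e, 'm) automaton_scheme) \<Rightarrow> ('i \<Rightarrow> 'q set) \<Rightarrow> ('i \<Rightarrow> 'q) set" where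
  "or_secret I G QS = states (sync I G) - PiE I (\<lambda>i. states (G i) - QS i)"

definition current_state_opaque :: "('q, 'e, 'm) automaton_scheme \<Rightarrow> 'q set \<Rightarrow> bool" where
  "current_state_opaque G QS \<longleftrightarrow>
     (\<forall>q0\<in>initial G. \<forall>s\<in>lang G q0.
        (\<exists>q\<in>QS. weak_run G q0 s q) \<longrightarrow>
        (\<exists>q0'\<in>initial G. \<exists>q\<in>states G - QS. weak_run G q0' s q))"

definition UR :: "('q, 'e, 'm) automaton_scheme \<Rightarrow> 'q set \<Rightarrow> 'q set" where
  "UR G B = {q. \<exists>p\<in>B. \<exists>t. set t \<subseteq> {None} \<and> run G p t q}"

definition subset_automaton :: "('q, 'e, 'm) automaton_scheme \<Rightarrow> ('q set, 'e) automaton" where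
  "subset_automaton G =
     \<lparr>alphabet = alphabet G,
      states = Pow (states G),
      transitions =
        {(X, Some \<sigma>, Y) | X \<sigma> Y.
           X \<subseteq> states G \<and> \<sigma> \<in> alphabet G \<and>
           Y = \<Union>{UR G {y} | x y. x \<in> X \<and> (x, Some \<sigma>, y) \<in> transitions G} \<and> Y \<noteq> {}},
      initial = {UR G (initial G)}\<rparr>"

definition accessible_part :: "('q, 'e) automaton \<Rightarrow> ('q, 'e) automaton" where
  "accessible_part A =
     A\<lparr>states := reachable A,
       transitions := transitions A \<inter> (reachable A \<times> UNIV \<times> reachable A)\<rparr>"

definition det :: "('q, 'e, 'm) automaton_scheme \<Rightarrow> ('q set, 'e) automaton" where
  "det G = accessible_part (subset_automaton G)"

text \<open>The new state \<open>\<bottom>\<close> is \<open>None\<close>; an original state \<open>x\<close> becomes \<open>Some x\<close>.\<close>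

definition psi_automaton ::
  "('q, 'e) automaton \<Rightarrow> 'q set \<Rightarrow> 'e \<Rightarrow> ('q option, 'e) marked_automaton" where
  "psi_automaton D Xpsi \<psi> =
     \<lparr>alphabet = insert \<psi> (alphabet D),
      states = insert None (Some ` states D),
      transitions =
        {(Some x, a, Some y) | x a y. (x, a, y) \<in> transitions D} \<union>
        {(Some x, Some \<psi>, None) | x. x \<in> Xpsi},
      initial = Some ` initial D,
      marked = Some ` states D\<rparr>"

definition blocking :: "('q, 'e) marked_automaton \<Rightarrow> bool" where
  "blocking M \<longleftrightarrow> (\<exists>q\<in>reachable M. \<not> (\<exists>t. \<exists>m\<in>marked M. run M q t m))"

end

theory Submission imports Defs begin

text \<open>The set of states of \<open>G\<^sub>1 \<parallel> \<dots> \<parallel> G\<^sub>n\<close> reached by an observable word \<open>s\<close> is the product of the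
  state estimates \<open>X\<^sub>i\<close> of the components after the projections of \<open>s\<close>. Hence opacity fails iff some
  \<open>s\<close> gives nonempty estimates one of which satisfies \<open>X\<^sub>i \<subseteq> Q\<^sub>i\<^sup>S\<close>. These are exactly the tuples from
  which the composition of the \<open>\<psi>\<close>-automata can execute some \<open>\<psi>\<^sub>i\<close>; doing so puts component \<open>i\<close> into
  \<open>\<bottom>\<close> forever, and this is the only way to reach a state without a path to a marked state.\<close>

section \<open>Runs and reachability\<close>

lemma run_append: "run G p (t @ u) q \<longleftrightarrow> (\<exists>r. run G p t r \<and> run G r u q)"
  by (induction t arbitrary: p) auto

lemma reachable_initial: "q \<in> initial G \<Longrightarrow> q \<in> reachable G"
  unfolding reachable_def by (auto intro!: bexI[of _ q] exI[of _ "[]"])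

lemma reachable_step:
  assumes "p \<in> reachable G" "(p, a, q) \<in> transitions G"
  shows "q \<in> reachable G"
proof -
  obtain q0 t where "q0 \<in> initial G" "run G q0 t p"
    using assms(1) by (auto simp: reachable_def)
  then have "run G q0 (t @ [a]) q"
    using assms(2) by (auto simp: run_append)
  then show ?thesis
    using \<open>q0 \<in> initial G\<close> by (auto simp: reachable_def)
qed

lemma reachable_induct [consumes 1, case_names initial step]:
  assumes "q \<in> reachable G"
    and init: "\<And>q. q \<in> initial G \<Longrightarrow> P q"
    and step: "\<And>p a q. p \<in> reachable G \<Longrightarrow> P p \<Longrightarrow> (p, a, q) \<in> transitions G \<Longrightarrow> P q"
  shows "P q"
proof -
  obtain q0 t where q0: "q0 \<in> initial G" and "run G q0 t q"
    using assms(1) by (auto simp: reachable_def)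
  then have "P q \<and> q \<in> reachable G"
  proof (induction t arbitrary: q rule: rev_induct)
    case Nil
    then show ?case by (auto intro: init reachable_initial)
  next
    case (snoc a t)
    then obtain r where "run G q0 t r" "(r, a, q) \<in> transitions G"
      by (auto simp: run_append)
    with snoc show ?case by (blast intro: step reachable_step)
  qed
  then show ?thesis ..
qed

section \<open>Unobservable reach and state estimates\<close>

definition tau_steps :: "('q, 'e, 'm) automaton_scheme \<Rightarrow> ('q \<times> 'q) set" where
  "tau_steps G = {(p, q). (p, None, q) \<in> transitions G}"

definition post :: "('q, 'e, 'm) automaton_scheme \<Rightarrow> 'e \<Rightarrow> 'q set \<Rightarrow> 'q set" where
  "post G \<sigma> B = {y. \<exists>x\<in>B. (x, Some \<sigma>, y) \<in> transitions G}"

text \<open>Unlike the state of \<open>det G\<close> after \<open>s\<close>, this is total: a word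
  that cannot be executed gets the empty set, so executability becomes nonemptiness.\<close>

definition estimate :: "('q, 'e, 'm) automaton_scheme \<Rightarrow> 'e list \<Rightarrow> 'q set" where
  "estimate G s = {q. \<exists>q0\<in>initial G. weak_run G q0 s q}"

text \<open>Trades lists of \<open>None\<close> for the closure of a relation, so that induction and
  algebra for \<open>rtrancl\<close> apply to \<open>UR\<close>.\<close>

lemma run_tau_iff:
  "(\<exists>t. set t \<subseteq> {None} \<and> run G p t q) \<longleftrightarrow> (p, q) \<in> (tau_steps G)\<^sup>*"
proof
  assume "\<exists>t. set t \<subseteq> {None} \<and> run G p t q"
  then obtain t where "set t \<subseteq> {None}" "run G p t q" by blast
  then show "(p, q) \<in> (tau_steps G)\<^sup>*"
  proof (induction t arbitrary: p)
    case (Cons a t)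
    then obtain r where "(p, r) \<in> tau_steps G" "run G r t q"
      by (auto simp: tau_steps_def)
    with Cons show ?case by (auto intro: converse_rtrancl_into_rtrancl)
  qed auto
next
  assume "(p, q) \<in> (tau_steps G)\<^sup>*"
  then show "\<exists>t. set t \<subseteq> {None} \<and> run G p t q"
  proof (induction rule: converse_rtrancl_induct)
    case base
    then show ?case by (intro exI[of _ "[]"]) auto
  next
    case (step p r)
    then obtain t where "set t \<subseteq> {None}" "run G r t q" by blast
    with step show ?case by (intro exI[of _ "None # t"]) (auto simp: tau_steps_def)
  qed
qed

lemma UR_eq: "UR G B = (tau_steps G)\<^sup>* `` B"
  unfolding UR_def by (auto simp: run_tau_iff Image_def Bex_def)

lemma UR_idem: "UR G (UR G B) = UR G B"
proof -
  have "(tau_steps G)\<^sup>* O (tau_steps G)\<^sup>* = (tau_steps G)\<^sup>*" by simp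
  then show ?thesis unfolding UR_eq by blast
qed

lemma erase_tau_Nil: "erase_tau t = [] \<longleftrightarrow> set t \<subseteq> {None}"
  by (auto simp: erase_tau_def filter_empty_conv)

text \<open>Cuts \<open>t\<close> at its last observable event. The trailing \<tau>s form the block
  that the estimator absorbs by \<open>UR\<close> after each event; hence words are extended at the
  right end throughout.\<close>

lemma erase_tau_snoc:
  "erase_tau t = s @ [\<sigma>] \<longleftrightarrow>
   (\<exists>t1 t2. t = t1 @ Some \<sigma> # t2 \<and> erase_tau t1 = s \<and> set t2 \<subseteq> {None})"
proof
  assume "erase_tau t = s @ [\<sigma>]"
  then show "\<exists>t1 t2. t = t1 @ Some \<sigma> # t2 \<and> erase_tau t1 = s \<and> set t2 \<subseteq> {None}"
  proof (induction t rule: rev_induct)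
    case Nil
    then show ?case by (simp add: erase_tau_def)
  next
    case (snoc a t)
    show ?case
    proof (cases a)
      case None
      with snoc obtain t1 t2 where "t = t1 @ Some \<sigma> # t2 \<and> erase_tau t1 = s \<and> set t2 \<subseteq> {None}"
        by (auto simp: erase_tau_def)
      with None show ?thesis by (intro exI[of _ t1] exI[of _ "t2 @ [None]"]) auto
    next
      case (Some b)
      with snoc.prems show ?thesis
        by (intro exI[of _ t] exI[of _ "[]"]) (auto simp: erase_tau_def)
    qed
  qed
next
  assume "\<exists>t1 t2. t = t1 @ Some \<sigma> # t2 \<and> erase_tau t1 = s \<and> set t2 \<subseteq> {None}"
  then obtain t1 t2 where t: "t = t1 @ Some \<sigma> # t2" "erase_tau t1 = s" "erase_tau t2 = []"
    by (auto simp: erase_tau_Nil)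
  then show "erase_tau t = s @ [\<sigma>]" by (simp add: erase_tau_def)
qed

lemma estimate_Nil: "estimate G [] = UR G (initial G)"
  by (auto simp: estimate_def weak_run_def erase_tau_Nil UR_def)

lemma estimate_snoc: "estimate G (s @ [\<sigma>]) = UR G (post G \<sigma> (estimate G s))"
proof (intro set_eqI)
  fix q
  have "q \<in> estimate G (s @ [\<sigma>]) \<longleftrightarrow>
    (\<exists>q0\<in>initial G. \<exists>t1 t2. erase_tau t1 = s \<and> set t2 \<subseteq> {None} \<and> run G q0 (t1 @ Some \<sigma> # t2) q)"
    unfolding estimate_def weak_run_def erase_tau_snoc by blast
  also have "\<dots> \<longleftrightarrow> q \<in> UR G (post G \<sigma> (estimate G s))"
    unfolding estimate_def weak_run_def UR_def post_def run_append by auto blast+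
  finally show "q \<in> estimate G (s @ [\<sigma>]) \<longleftrightarrow> q \<in> UR G (post G \<sigma> (estimate G s))" .
qed

lemma UR_estimate: "UR G (estimate G s) = estimate G s"
  by (cases s rule: rev_cases) (simp_all add: estimate_Nil estimate_snoc UR_idem)

lemma estimate_snoc_nonempty: "estimate G (s @ [\<sigma>]) \<noteq> {} \<Longrightarrow> estimate G s \<noteq> {}"
  by (auto simp: estimate_snoc post_def UR_eq)

lemma UR_subset_states:
  assumes "wf_automaton G" "B \<subseteq> states G"
  shows "UR G B \<subseteq> states G"
proof -
  have "q \<in> states G" if "(p, q) \<in> (tau_steps G)\<^sup>*" "p \<in> states G" for p q
    using that
    by (induction rule: rtrancl_induct) (use assms(1) in \<open>auto simp: tau_steps_def wf_automaton_def\<close>)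
  then show ?thesis using assms(2) by (auto simp: UR_eq)
qed

lemma post_subset_states: "wf_automaton G \<Longrightarrow> post G \<sigma> B \<subseteq> states G"
  by (auto simp: post_def wf_automaton_def)

lemma estimate_subset_states: "wf_automaton G \<Longrightarrow> estimate G s \<subseteq> states G"
  by (cases s rule: rev_cases)
    (simp_all add: estimate_Nil estimate_snoc UR_subset_states post_subset_states,
      simp add: UR_subset_states wf_automaton_def)

lemma estimate_events:
  assumes "wf_automaton G" "estimate G s \<noteq> {}"
  shows "set s \<subseteq> alphabet G"
  using assms(2)
proof (induction s rule: rev_induct)
  case (snoc \<sigma> s)
  then have "post G \<sigma> (estimate G s) \<noteq> {}"
    by (auto simp: estimate_snoc UR_eq)
  then have "\<sigma> \<in> alphabet G"
    using assms(1) by (auto simp: post_def wf_automaton_def)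
  with snoc estimate_snoc_nonempty show ?case by fastforce
qed simp

subsection \<open>Estimates of a synchronous composition\<close>

lemma sync_simps:
  "alphabet (sync I G) = (\<Union>i\<in>I. alphabet (G i))"
  "states (sync I G) = PiE I (\<lambda>i. states (G i))"
  "initial (sync I G) = PiE I (\<lambda>i. initial (G i))"
  by (simp_all add: sync_def)

lemma sync_transition_Some:
  "(x, Some \<sigma>, y) \<in> transitions (sync I G) \<longleftrightarrow>
     x \<in> PiE I (\<lambda>i. states (G i)) \<and> y \<in> PiE I (\<lambda>i. states (G i)) \<and>
     \<sigma> \<in> (\<Union>i\<in>I. alphabet (G i)) \<and>
     (\<forall>i\<in>I. if \<sigma> \<in> alphabet (G i) then (x i, Some \<sigma>, y i) \<in> transitions (G i) else y i = x i)"
  by (simp add: sync_def)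

lemma sync_transition_None:
  "(x, None, y) \<in> transitions (sync I G) \<longleftrightarrow>
     x \<in> PiE I (\<lambda>i. states (G i)) \<and> y \<in> PiE I (\<lambda>i. states (G i)) \<and>
     (\<exists>i\<in>I. (x i, None, y i) \<in> transitions (G i) \<and> (\<forall>j\<in>I. j \<noteq> i \<longrightarrow> y j = x j))"
  by (simp add: sync_def)

lemma wf_automaton_sync:
  assumes "finite I" "\<And>i. i \<in> I \<Longrightarrow> wf_automaton (G i)"
  shows "wf_automaton (sync I G)"
proof -
  have "a \<in> insert None (Some ` alphabet (sync I G)) \<and> x \<in> states (sync I G) \<and> y \<in> states (sync I G)"
    if "(x, a, y) \<in> transitions (sync I G)" for x a y
    using that by (cases a) (auto simp: sync_transition_None sync_transition_Some sync_simps)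
  moreover have "initial (sync I G) \<subseteq> states (sync I G)"
    using assms(2) by (auto simp: sync_simps wf_automaton_def intro!: PiE_mono)
  moreover have "finite (states (sync I G))" "finite (alphabet (sync I G))"
    using assms by (auto simp: sync_simps wf_automaton_def intro!: finite_PiE)
  ultimately show ?thesis by (auto simp: wf_automaton_def)
qed

lemma sync_tau_component:
  assumes "(x, y) \<in> (tau_steps (sync I G))\<^sup>*" "i \<in> I"
  shows "(x i, y i) \<in> (tau_steps (G i))\<^sup>*"
  using assms(1)
proof (induction rule: rtrancl_induct)
  case (step y z)
  \<comment> \<open>A global \<tau>-step moves one component, which may or may not be
    \<open>i\<close>; hence the reflexive closure.\<close>
  then have "(y i, z i) \<in> (tau_steps (G i))\<^sup>="
    using \<open>i \<in> I\<close> by (cases "z i = y i") (auto simp: tau_steps_def sync_transition_None)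
  with step.IH show ?case by auto
qed simp

lemma sync_tau_update:
  assumes wf: "wf_automaton (G i)"
    and x: "x \<in> PiE I (\<lambda>i. states (G i))" and i: "i \<in> I"
    and "(x i, b) \<in> (tau_steps (G i))\<^sup>*"
  shows "(x, x(i := b)) \<in> (tau_steps (sync I G))\<^sup>*"
  using assms(4)
proof (induction rule: rtrancl_induct)
  case (step b c)
  then have "b \<in> states (G i)" "c \<in> states (G i)"
    using wf by (auto simp: tau_steps_def wf_automaton_def)
  then have "(x(i := b), x(i := c)) \<in> tau_steps (sync I G)"
    using step(2) x i
    by (auto simp: tau_steps_def sync_transition_None PiE_iff extensional_def intro!: bexI[of _ i])
  with step.IH show ?case by (rule rtrancl_into_rtrancl)
qed simp

text \<open>\<tau> is never synchronised, so the components can run their \<tau>-paths one after the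
  other.\<close>

lemma sync_tau_product:
  assumes "finite I" and wf: "\<And>i. i \<in> I \<Longrightarrow> wf_automaton (G i)"
    and x: "x \<in> PiE I (\<lambda>i. states (G i))" and y: "y \<in> PiE I (\<lambda>i. states (G i))"
    and xy: "\<And>i. i \<in> I \<Longrightarrow> (x i, y i) \<in> (tau_steps (G i))\<^sup>*"
  shows "(x, y) \<in> (tau_steps (sync I G))\<^sup>*"
proof -
  \<comment> \<open>\<open>J\<close> collects the components that have already moved from
    \<open>x\<close> to \<open>y\<close>.\<close>
  have "(x, \<lambda>i. if i \<in> J then y i else x i) \<in> (tau_steps (sync I G))\<^sup>*" if "J \<subseteq> I" for J
    using finite_subset[OF that \<open>finite I\<close>] that
  proof (induction J rule: finite_induct)
    case (insert j J)
    let ?z = "\<lambda>i. if i \<in> J then y i else x i"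
    have "?z \<in> PiE I (\<lambda>i. states (G i))"
      using x y by (auto simp: PiE_iff extensional_def)
    moreover have "(?z j, y j) \<in> (tau_steps (G j))\<^sup>*"
      using xy insert by auto
    ultimately have "(?z, ?z(j := y j)) \<in> (tau_steps (sync I G))\<^sup>*"
      using insert.prems by (intro sync_tau_update wf) auto
    also have "?z(j := y j) = (\<lambda>i. if i \<in> insert j J then y i else x i)"
      by auto
    finally show ?case using insert by (meson insert_subset rtrancl_trans)
  qed simp
  from this[of I] have "(x, \<lambda>i. if i \<in> I then y i else x i) \<in> (tau_steps (sync I G))\<^sup>*"
    by simp
  \<comment> \<open>Outside \<open>I\<close> both tuples are \<open>undefined\<close>, by
    extensionality.\<close>
  also have "(\<lambda>i. if i \<in> I then y i else x i) = y"
    using x y by (auto simp: PiE_iff extensional_def)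
  finally show ?thesis .
qed

lemma UR_sync:
  assumes "finite I" and wf: "\<And>i. i \<in> I \<Longrightarrow> wf_automaton (G i)"
    and B: "\<And>i. i \<in> I \<Longrightarrow> B i \<subseteq> states (G i)"
  shows "UR (sync I G) (PiE I B) = PiE I (\<lambda>i. UR (G i) (B i))"
proof (intro equalityI subsetI)
  fix y assume y: "y \<in> UR (sync I G) (PiE I B)"
  then obtain x where x: "x \<in> PiE I B" and xy: "(x, y) \<in> (tau_steps (sync I G))\<^sup>*"
    by (auto simp: UR_eq)
  have "PiE I B \<subseteq> states (sync I G)"
    using B by (auto simp: sync_simps intro!: PiE_mono)
  with y have "y \<in> states (sync I G)"
    using UR_subset_states[OF wf_automaton_sync[where G = G, OF assms(1) wf], of "PiE I B"] by blast
  then show "y \<in> PiE I (\<lambda>i. UR (G i) (B i))"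
    using x sync_tau_component[OF xy] by (auto simp: sync_simps PiE_iff UR_eq)
next
  fix y assume y: "y \<in> PiE I (\<lambda>i. UR (G i) (B i))"
  then have "\<forall>i\<in>I. \<exists>b\<in>B i. (b, y i) \<in> (tau_steps (G i))\<^sup>*"
    by (auto simp: PiE_iff UR_eq)
  then obtain f where f: "\<And>i. i \<in> I \<Longrightarrow> f i \<in> B i \<and> (f i, y i) \<in> (tau_steps (G i))\<^sup>*"
    by metis
  have "y \<in> PiE I (\<lambda>i. states (G i))"
    using y UR_subset_states[OF wf B] by (fastforce simp: PiE_iff)
  \<comment> \<open>The choice function is arbitrary outside \<open>I\<close>; restricting it yields
    a genuine tuple.\<close>
  moreover have "restrict f I \<in> PiE I (\<lambda>i. states (G i))"
    using f B by auto
  ultimately have "(restrict f I, y) \<in> (tau_steps (sync I G))\<^sup>*"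
    using f by (intro sync_tau_product assms) auto
  moreover have "restrict f I \<in> PiE I B" using f by auto
  ultimately show "y \<in> UR (sync I G) (PiE I B)" unfolding UR_eq by blast
qed

text \<open>A joint event constrains each of its participants separately and freezes the others, so
  successors of a product form a product. For \<sigma> owned by no component the left side would be
  empty, while the right side would be \<open>PiE I B\<close>.\<close>

lemma post_sync:
  assumes wf: "\<And>i. i \<in> I \<Longrightarrow> wf_automaton (G i)"
    and B: "\<And>i. i \<in> I \<Longrightarrow> B i \<subseteq> states (G i)"
    and \<sigma>: "\<sigma> \<in> (\<Union>i\<in>I. alphabet (G i))"
  shows "post (sync I G) \<sigma> (PiE I B) =
    PiE I (\<lambda>i. if \<sigma> \<in> alphabet (G i) then post (G i) \<sigma> (B i) else B i)"
proof (intro equalityI subsetI)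
  fix y assume "y \<in> post (sync I G) \<sigma> (PiE I B)"
  then obtain x where x: "x \<in> PiE I B" and tr: "(x, Some \<sigma>, y) \<in> transitions (sync I G)"
    by (auto simp: post_def)
  have "y i \<in> (if \<sigma> \<in> alphabet (G i) then post (G i) \<sigma> (B i) else B i)" if i: "i \<in> I" for i
  proof -
    have "x i \<in> B i" using x i by auto
    moreover have "if \<sigma> \<in> alphabet (G i) then (x i, Some \<sigma>, y i) \<in> transitions (G i) else y i = x i"
      using tr i by (simp add: sync_transition_Some)
    ultimately show ?thesis by (auto simp: post_def)
  qed
  moreover have "y \<in> extensional I"
    using tr by (simp add: sync_transition_Some PiE_iff)
  ultimately show "y \<in> PiE I (\<lambda>i. if \<sigma> \<in> alphabet (G i) then post (G i) \<sigma> (B i) else B i)"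
    unfolding PiE_iff by blast
next
  fix y assume y: "y \<in> PiE I (\<lambda>i. if \<sigma> \<in> alphabet (G i) then post (G i) \<sigma> (B i) else B i)"
  have "\<exists>b\<in>B i. if \<sigma> \<in> alphabet (G i) then (b, Some \<sigma>, y i) \<in> transitions (G i) else y i = b"
    if "i \<in> I" for i
    using PiE_mem[OF y that] by (auto simp: post_def split: if_splits)
  then obtain f where f: "\<And>i. i \<in> I \<Longrightarrow> f i \<in> B i \<and>
      (if \<sigma> \<in> alphabet (G i) then (f i, Some \<sigma>, y i) \<in> transitions (G i) else y i = f i)"
    by metis
  have "y i \<in> states (G i)" if "i \<in> I" for i
    using f[OF that] B[OF that] wf[OF that] by (auto simp: wf_automaton_def split: if_splits)
  then have "(restrict f I, Some \<sigma>, y) \<in> transitions (sync I G)"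
    using f B \<sigma> y by (auto simp: sync_transition_Some PiE_iff)
  moreover have "restrict f I \<in> PiE I B" using f by auto
  ultimately show "y \<in> post (sync I G) \<sigma> (PiE I B)" unfolding post_def by blast
qed

abbreviation project :: "('q, 'e, 'm) automaton_scheme \<Rightarrow> 'e list \<Rightarrow> 'e list" where
  "project G s \<equiv> filter (\<lambda>\<sigma>. \<sigma> \<in> alphabet G) s"

text \<open>Since estimates are closed under \<open>UR\<close>, the closure can be written even when
  \<sigma> is erased. Both cases then have the shape that \<open>UR_sync\<close> delivers.\<close>

lemma estimate_project_snoc:
  "estimate G (project G (s @ [\<sigma>])) =
    UR G (if \<sigma> \<in> alphabet G then post G \<sigma> (estimate G (project G s)) else estimate G (project G s))"
  by (simp add: estimate_snoc UR_estimate)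

text \<open>Both stages of an estimator update, \<open>post\<close> and \<open>UR\<close>, factor
  over products. The bound on \<open>s\<close> matters: all projections drop a foreign event, but
  the composition cannot execute it.\<close>

lemma estimate_sync:
  assumes "finite I" and wf: "\<And>i. i \<in> I \<Longrightarrow> wf_automaton (G i)"
    and "set s \<subseteq> (\<Union>i\<in>I. alphabet (G i))"
  shows "estimate (sync I G) s = PiE I (\<lambda>i. estimate (G i) (project (G i) s))"
  using assms(3)
proof (induction s rule: rev_induct)
  case Nil
  have "initial (G i) \<subseteq> states (G i)" if "i \<in> I" for i
    using wf[OF that] by (simp add: wf_automaton_def)
  then show ?case
    by (simp add: estimate_Nil sync_simps UR_sync assms(1) wf)
next
  case (snoc \<sigma> s)
  have "estimate (sync I G) (s @ [\<sigma>]) =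
      UR (sync I G) (post (sync I G) \<sigma> (PiE I (\<lambda>i. estimate (G i) (project (G i) s))))"
    using snoc by (simp add: estimate_snoc)
  also have "\<dots> = UR (sync I G) (PiE I (\<lambda>i. if \<sigma> \<in> alphabet (G i)
      then post (G i) \<sigma> (estimate (G i) (project (G i) s)) else estimate (G i) (project (G i) s)))"
    using snoc.prems by (subst post_sync) (auto simp: wf dest: subsetD[OF estimate_subset_states[OF wf]])
  also have "\<dots> = PiE I (\<lambda>i. estimate (G i) (project (G i) (s @ [\<sigma>])))"
    unfolding estimate_project_snoc
    by (rule UR_sync)
      (simp_all add: assms(1) wf estimate_subset_states post_subset_states)
  finally show ?case .
qed

section \<open>Words that witness non-opacity\<close>

definition revealing ::
  "'i set \<Rightarrow> ('i \<Rightarrow> ('q, 'e, 'm) automaton_scheme) \<Rightarrow> ('i \<Rightarrow> 'q set) \<Rightarrow> 'e list \<Rightarrow> bool" where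
  "revealing I G QS s \<longleftrightarrow>
     set s \<subseteq> (\<Union>i\<in>I. alphabet (G i)) \<and>
     (\<forall>i\<in>I. estimate (G i) (project (G i) s) \<noteq> {}) \<and>
     (\<exists>i\<in>I. estimate (G i) (project (G i) s) \<subseteq> QS i)"

text \<open>A violating word is one with a nonempty estimate and no non-secret state in it; as
  estimates consist of states, the latter is inclusion in \<open>QS\<close>.\<close>

lemma not_opaque_iff_estimate:
  assumes "wf_automaton G"
  shows "\<not> current_state_opaque G QS \<longleftrightarrow> (\<exists>s. estimate G s \<noteq> {} \<and> estimate G s \<subseteq> QS)"
  using estimate_subset_states[OF assms]
  unfolding current_state_opaque_def estimate_def lang_def by blast

text \<open>\<open>revealing\<close> speaks only of component estimates, and serves as the middle
  term between opacity and blocking.\<close>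

lemma not_opaque_sync_iff:
  assumes "finite I" and wf: "\<And>i. i \<in> I \<Longrightarrow> wf_automaton (G i)"
  shows "\<not> current_state_opaque (sync I G) (or_secret I G QS) \<longleftrightarrow> (\<exists>s. revealing I G QS s)"
proof -
  note wfs = wf_automaton_sync[where G = G, OF assms(1) wf]
  have "estimate (sync I G) s \<noteq> {} \<and> estimate (sync I G) s \<subseteq> or_secret I G QS \<longleftrightarrow>
      revealing I G QS s" for s
  proof (cases "set s \<subseteq> (\<Union>i\<in>I. alphabet (G i))")
    \<comment> \<open>A word with a foreign event has an empty estimate in the composition and is
      not \<open>revealing\<close>: both sides fail.\<close>
    case False
    then show ?thesis
      using estimate_events[OF wfs, of s] by (auto simp: revealing_def sync_simps)
  next
    case True
    let ?E = "\<lambda>i. estimate (G i) (project (G i) s)"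
    have E: "estimate (sync I G) s = PiE I ?E" by (rule estimate_sync[OF assms True])
    \<comment> \<open>The complement of the secret set is a product, so inclusion becomes
      disjointness of two products. Their intersection is again a product, which is empty iff one
      factor is.\<close>
    have "PiE I ?E \<subseteq> or_secret I G QS \<longleftrightarrow> PiE I ?E \<inter> PiE I (\<lambda>i. states (G i) - QS i) = {}"
      using estimate_subset_states[OF wfs, of s] unfolding E or_secret_def by blast
    also have "PiE I ?E \<inter> PiE I (\<lambda>i. states (G i) - QS i) = PiE I (\<lambda>i. ?E i - QS i)"
      using estimate_subset_states[OF wf] by (fastforce simp: PiE_iff)
    also have "\<dots> = {} \<longleftrightarrow> (\<exists>i\<in>I. ?E i \<subseteq> QS i)"
      by (auto simp: PiE_eq_empty_iff)
    finally show ?thesis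
      using True unfolding E revealing_def by (auto simp: PiE_eq_empty_iff)
  qed
  then show ?thesis using not_opaque_iff_estimate[OF wfs] by simp
qed

subsection \<open>The composition of the estimators\<close>

text \<open>\<open>UR\<close> distributes over unions, so the estimator's union of closures is one
  closure of \<open>post\<close>.\<close>

lemma UN_UR_eq: "\<Union>{UR G {y} | x y. x \<in> X \<and> (x, Some \<sigma>, y) \<in> transitions G} = UR G (post G \<sigma> X)"
  by (auto simp: UR_eq post_def)

lemma subset_automaton_transition:
  "(X, a, Y) \<in> transitions (subset_automaton G) \<longleftrightarrow>
    (\<exists>\<sigma>. a = Some \<sigma> \<and> X \<subseteq> states G \<and> \<sigma> \<in> alphabet G \<and> Y = UR G (post G \<sigma> X) \<and> Y \<noteq> {})"
  unfolding subset_automaton_def by (auto simp: UN_UR_eq)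

lemma estimate_in_reachable:
  assumes "wf_automaton G" "estimate G s \<noteq> {}"
  shows "estimate G s \<in> reachable (subset_automaton G)"
  using assms(2)
proof (induction s rule: rev_induct)
  case Nil
  then show ?case
    by (intro reachable_initial) (simp add: subset_automaton_def estimate_Nil)
next
  case (snoc \<sigma> s)
  have "(estimate G s, Some \<sigma>, estimate G (s @ [\<sigma>])) \<in> transitions (subset_automaton G)"
    using snoc.prems estimate_events[OF assms(1) snoc.prems] estimate_subset_states[OF assms(1)]
    by (simp add: subset_automaton_transition estimate_snoc)
  with snoc.IH estimate_snoc_nonempty[OF snoc.prems] show ?case by (metis reachable_step)
qed

lemma det_simps:
  "alphabet (det G) = alphabet G"
  "states (det G) = reachable (subset_automaton G)"
  "initial (det G) = {estimate G []}"
  by (simp_all add: det_def accessible_part_def subset_automaton_def estimate_Nil)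

lemma det_transition_None: "(X, None, Y) \<notin> transitions (det G)"
  by (simp add: det_def accessible_part_def subset_automaton_transition)

text \<open>On states of the form \<open>estimate G s\<close>, \<open>det\<close> just appends the
  event to the word; it has no move exactly where the word stops being executable.\<close>

lemma det_transition_estimate:
  assumes "wf_automaton G" "estimate G s \<noteq> {}"
  shows "(estimate G s, Some \<sigma>, Y) \<in> transitions (det G) \<longleftrightarrow>
    Y = estimate G (s @ [\<sigma>]) \<and> Y \<noteq> {}"
proof
  assume "(estimate G s, Some \<sigma>, Y) \<in> transitions (det G)"
  then show "Y = estimate G (s @ [\<sigma>]) \<and> Y \<noteq> {}"
    by (auto simp: det_def accessible_part_def subset_automaton_transition estimate_snoc)
next
  assume Y: "Y = estimate G (s @ [\<sigma>]) \<and> Y \<noteq> {}"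
  then have "\<sigma> \<in> alphabet G"
    using estimate_events[OF assms(1), of "s @ [\<sigma>]"] by auto
  with Y show "(estimate G s, Some \<sigma>, Y) \<in> transitions (det G)"
    using estimate_in_reachable[OF assms] estimate_in_reachable[OF assms(1), of "s @ [\<sigma>]"]
      estimate_subset_states[OF assms(1)]
    by (auto simp: det_def accessible_part_def subset_automaton_transition estimate_snoc)
qed

section \<open>\<psi>-automata and their composition\<close>

lemma psi_automaton_simps:
  "alphabet (psi_automaton D X \<psi>) = insert \<psi> (alphabet D)"
  "states (psi_automaton D X \<psi>) = insert None (Some ` states D)"
  "initial (psi_automaton D X \<psi>) = Some ` initial D"
  "marked (psi_automaton D X \<psi>) = Some ` states D"
  by (simp_all add: psi_automaton_def)

lemma psi_automaton_transition:
  "(None, a, z) \<notin> transitions (psi_automaton D X \<psi>)"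
  "(Some x, a, Some y) \<in> transitions (psi_automaton D X \<psi>) \<longleftrightarrow> (x, a, y) \<in> transitions D"
  "(Some x, a, None) \<in> transitions (psi_automaton D X \<psi>) \<longleftrightarrow> a = Some \<psi> \<and> x \<in> X"
  by (auto simp: psi_automaton_def)

lemma sync_marked_simps:
  "transitions (sync_marked I M) = transitions (sync I M)"
  "initial (sync_marked I M) = PiE I (\<lambda>i. initial (M i))"
  "marked (sync_marked I M) = PiE I (\<lambda>i. marked (M i))"
  by (simp_all add: sync_marked_def automaton.defs marked_automaton.defs sync_def)

text \<open>A component without outgoing transitions disables every event of its alphabet for the
  whole composition and cannot make a \<tau>-step, so it can only stay put.\<close>

lemma run_sync_dead_component:
  assumes "run (sync_marked I M) x t y" "i \<in> I" "x i = d"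
    and dead: "\<And>a z. (d, a, z) \<notin> transitions (M i)"
  shows "y i = d"
  using assms(1,3)
proof (induction t arbitrary: x)
  case (Cons a t)
  then obtain z where z: "(x, a, z) \<in> transitions (sync I M)" "run (sync_marked I M) z t y"
    by (auto simp: sync_marked_simps)
  have "z i = d"
  proof (cases a)
    case None
    then show ?thesis
      using z(1) Cons.prems(2) dead \<open>i \<in> I\<close> by (cases "z i = x i") (auto simp: sync_transition_None)
  next
    case (Some \<sigma>)
    then show ?thesis
      using z(1) Cons.prems(2) dead \<open>i \<in> I\<close> by (auto simp: sync_transition_Some split: if_splits)
  qed
  with Cons.IH z(2) show ?case by blast
qed simp

text \<open>\<open>inj\<close> and \<open>fresh\<close> together make each \<open>\<psi> i\<close>
  private to component \<open>i\<close>. Without \<open>initial_nonempty\<close>, an empty initial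
  estimate would be a \<psi>-state and cause blocking, although a composition without initial states
  is vacuously opaque.\<close>

locale psi_composition =
  fixes I :: "'i set"
    and G :: "'i \<Rightarrow> ('q, 'e, 'm) automaton_scheme"
    and QS :: "'i \<Rightarrow> 'q set"
    and \<psi> :: "'i \<Rightarrow> 'e"
  assumes wf: "i \<in> I \<Longrightarrow> wf_automaton (G i)"
    and initial_nonempty: "i \<in> I \<Longrightarrow> initial (G i) \<noteq> {}"
    and inj: "inj_on \<psi> I"
    and fresh: "i \<in> I \<Longrightarrow> \<psi> i \<notin> (\<Union>j\<in>I. alphabet (G j))"
begin

definition M :: "'i \<Rightarrow> ('q set option, 'e) marked_automaton" where
  "M i = psi_automaton (det (G i)) {X \<in> states (det (G i)). X \<subseteq> QS i} (\<psi> i)"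

definition E :: "'e list \<Rightarrow> 'i \<Rightarrow> 'q set" where
  "E s i = estimate (G i) (project (G i) s)"

text \<open>The state of the composed \<psi>-automata after \<open>s\<close>, provided all
  \<open>E s i\<close> are nonempty and no \<psi> event has occurred.\<close>

definition tuple :: "'e list \<Rightarrow> 'i \<Rightarrow> 'q set option" where
  "tuple s = (\<lambda>i\<in>I. Some (E s i))"

lemma E_in_states: "i \<in> I \<Longrightarrow> E s i \<noteq> {} \<Longrightarrow> E s i \<in> states (det (G i))"
  by (simp add: E_def det_simps estimate_in_reachable wf)

lemma tuple_in_states:
  assumes "\<And>i. i \<in> I \<Longrightarrow> E s i \<noteq> {}"
  shows "tuple s \<in> PiE I (\<lambda>i. states (M i))"
  using assms E_in_states by (auto simp: tuple_def M_def psi_automaton_simps)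

lemma E_snoc:
  "E (s @ [\<sigma>]) i =
    (if \<sigma> \<in> alphabet (G i) then estimate (G i) (project (G i) s @ [\<sigma>]) else E s i)"
  by (simp add: E_def)

lemma E_snoc_nonempty: "E (s @ [\<sigma>]) i \<noteq> {} \<Longrightarrow> E s i \<noteq> {}"
  using estimate_snoc_nonempty[of "G i" "project (G i) s"]
  by (auto simp: E_snoc E_def split: if_splits)

text \<open>Freshness rules out the move to \<open>None\<close> on an event of \<open>G i\<close>,
  which leaves only the move of the estimator.\<close>

lemma M_transition_E:
  assumes "i \<in> I" "E s i \<noteq> {}" "\<sigma> \<in> alphabet (G i)"
  shows "(Some (E s i), Some \<sigma>, z) \<in> transitions (M i) \<longleftrightarrow>
    z = Some (E (s @ [\<sigma>]) i) \<and> E (s @ [\<sigma>]) i \<noteq> {}"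
proof (cases z)
  case None
  then show ?thesis
    using assms fresh[of i] by (auto simp: M_def psi_automaton_transition)
next
  case (Some y)
  then show ?thesis
    using assms det_transition_estimate[OF wf, of i "project (G i) s" \<sigma> y]
    by (auto simp: M_def psi_automaton_transition E_def)
qed

lemma alphabet_M: "alphabet (M i) = insert (\<psi> i) (alphabet (G i))"
  by (simp add: M_def psi_automaton_simps det_simps)

lemma tuple_reachable:
  assumes "set s \<subseteq> (\<Union>i\<in>I. alphabet (G i))" "\<And>i. i \<in> I \<Longrightarrow> E s i \<noteq> {}"
  shows "tuple s \<in> reachable (sync_marked I M)"
  using assms
proof (induction s rule: rev_induct)
  case Nil
  show ?case
    by (intro reachable_initial)
      (auto simp: sync_marked_simps tuple_def M_def psi_automaton_simps det_simps E_def)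
next
  case (snoc \<sigma> s)
  have ne: "E s i \<noteq> {}" if "i \<in> I" for i
    using snoc.prems(2)[OF that] E_snoc_nonempty by blast
  have \<sigma>: "\<sigma> \<in> (\<Union>i\<in>I. alphabet (G i))"
    using snoc.prems(1) by simp
  have "(tuple s, Some \<sigma>, tuple (s @ [\<sigma>])) \<in> transitions (sync I M)"
    unfolding sync_transition_Some
  proof (intro conjI ballI)
    show "\<sigma> \<in> (\<Union>i\<in>I. alphabet (M i))" using \<sigma> by (auto simp: alphabet_M)
    fix i assume i: "i \<in> I"
    \<comment> \<open>Hence \<sigma> lies in the alphabet of \<open>M i\<close> exactly when it lies
      in that of \<open>G i\<close>.\<close>
    have "\<sigma> \<noteq> \<psi> i" using \<sigma> fresh[OF i] by blast
    then show "if \<sigma> \<in> alphabet (M i) then (tuple s i, Some \<sigma>, tuple (s @ [\<sigma>]) i) \<in> transitions (M i)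
        else tuple (s @ [\<sigma>]) i = tuple s i"
      using i ne[OF i] snoc.prems(2)[OF i]
      by (cases "\<sigma> \<in> alphabet (G i)")
        (simp_all add: alphabet_M tuple_def M_transition_E, simp add: E_snoc)
  qed (intro tuple_in_states ne snoc.prems(2); assumption)+
  moreover have "tuple s \<in> reachable (sync_marked I M)"
    using snoc.IH snoc.prems(1) ne by simp
  ultimately show ?case by (metis reachable_step sync_marked_simps(1))
qed

text \<open>States reached after a \<psi> event need no description: the first such event already
  exhibits a revealing word, and the first disjunct does not mention \<open>q\<close>.\<close>

lemma reachable_cases:
  assumes "q \<in> reachable (sync_marked I M)"
  shows "(\<exists>s. revealing I G QS s) \<or>
    (\<exists>s. set s \<subseteq> (\<Union>i\<in>I. alphabet (G i)) \<and> (\<forall>i\<in>I. E s i \<noteq> {}) \<and> q = tuple s)"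
  using assms
proof (induction rule: reachable_induct)
  case (initial q)
  then have "q = tuple []"
    by (auto simp: sync_marked_simps tuple_def M_def psi_automaton_simps det_simps E_def PiE_iff
        extensional_def fun_eq_iff)
  moreover have "E [] i \<noteq> {}" if "i \<in> I" for i
    using initial_nonempty[OF that] by (auto simp: E_def estimate_Nil UR_eq)
  ultimately show ?case by (intro disjI2 exI[of _ "[]"]) auto
next
  case (step p a q)
  show ?case
  proof (cases "\<exists>s. revealing I G QS s")
    case False
    with step obtain s where s: "set s \<subseteq> (\<Union>i\<in>I. alphabet (G i))"
      and ne: "\<And>i. i \<in> I \<Longrightarrow> E s i \<noteq> {}" and p: "p = tuple s"
      by blast
    have tr: "(tuple s, a, q) \<in> transitions (sync I M)"
      using step.hyps p by (simp add: sync_marked_simps)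
    show ?thesis
    proof (cases a)
      case None
      then obtain i where "i \<in> I" "(tuple s i, None, q i) \<in> transitions (M i)"
        using tr by (auto simp: sync_transition_None)
      \<comment> \<open>Impossible case: estimators have no \<tau>-transitions, and the added
        transitions carry an observable label.\<close>
      then show ?thesis
        by (cases "q i") (auto simp: tuple_def M_def psi_automaton_transition det_transition_None)
    next
      case (Some \<sigma>)
      note tr = tr[unfolded Some sync_transition_Some]
      show ?thesis
      \<comment> \<open>An old event extends \<open>s\<close>; any other event of the composition is
        some \<open>\<psi> i\<close>.\<close>
      proof (cases "\<sigma> \<in> (\<Union>i\<in>I. alphabet (G i))")
        case True
        have q: "q i = Some (E (s @ [\<sigma>]) i) \<and> E (s @ [\<sigma>]) i \<noteq> {}" if i: "i \<in> I" for i
        proof (cases "\<sigma> \<in> alphabet (G i)")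
          case \<sigma>: True
          then show ?thesis
            using tr i M_transition_E[OF i ne[OF i] \<sigma>] by (auto simp: alphabet_M tuple_def)
        next
          case \<sigma>: False
          then have "\<sigma> \<notin> alphabet (M i)"
            using True fresh[OF i] by (auto simp: alphabet_M)
          then show ?thesis
            using tr i ne[OF i] \<sigma> by (auto simp: tuple_def E_snoc)
        qed
        have "q = tuple (s @ [\<sigma>])"
          using tr q by (auto simp: tuple_def PiE_iff extensional_def fun_eq_iff)
        then show ?thesis
          using q s True by (intro disjI2 exI[of _ "s @ [\<sigma>]"]) auto
      next
        case new: False
        then obtain i where i: "i \<in> I" "\<sigma> = \<psi> i"
          using tr by (auto simp: alphabet_M)
        then have t: "(Some (E s i), Some \<sigma>, q i) \<in> transitions (M i)"
          using tr by (auto simp: alphabet_M tuple_def)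
        have "E s i \<subseteq> QS i"
        \<comment> \<open>A move to \<open>None\<close> starts in a \<psi>-state, which is the
          claim. A move to \<open>Some y\<close> would be an estimator move on the new event, a
          contradiction.\<close>
        proof (cases "q i")
          case None
          with t show ?thesis by (auto simp: M_def psi_automaton_transition)
        next
          case (Some y)
          with t have "(E s i, Some \<sigma>, y) \<in> transitions (det (G i))"
            by (simp add: M_def psi_automaton_transition)
          then have "\<sigma> \<in> alphabet (G i)"
            by (simp add: det_def accessible_part_def subset_automaton_transition)
          with new i show ?thesis by blast
        qed
        with i s ne have "revealing I G QS s" by (auto simp: revealing_def E_def)
        then show ?thesis by blast
      qed
    qed
  qed blast
qed

lemma blocking_iff_revealing: "blocking (sync_marked I M) \<longleftrightarrow> (\<exists>s. revealing I G QS s)"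
proof
  assume "blocking (sync_marked I M)"
  then obtain q where q: "q \<in> reachable (sync_marked I M)"
    and "\<not> (\<exists>t. \<exists>m\<in>marked (sync_marked I M). run (sync_marked I M) q t m)"
    by (auto simp: blocking_def)
  \<comment> \<open>Otherwise the empty run would lead from \<open>q\<close> to a marked
    state.\<close>
  then have "q \<notin> marked (sync_marked I M)"
    by (metis run.simps(1))
  moreover have "tuple s \<in> marked (sync_marked I M)" if "\<forall>i\<in>I. E s i \<noteq> {}" for s
    using that E_in_states by (auto simp: sync_marked_simps tuple_def M_def psi_automaton_simps)
  ultimately show "\<exists>s. revealing I G QS s"
    using reachable_cases[OF q] by blast
next
  assume "\<exists>s. revealing I G QS s"
  then obtain s i where s: "set s \<subseteq> (\<Union>i\<in>I. alphabet (G i))"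
    and ne: "\<And>i. i \<in> I \<Longrightarrow> E s i \<noteq> {}" and i: "i \<in> I" "E s i \<subseteq> QS i"
    by (auto simp: revealing_def E_def)
  \<comment> \<open>The state after executing \<open>s\<close> and then \<open>\<psi> i\<close>:
    only component \<open>i\<close> takes part and drops to \<bottom>.\<close>
  let ?q = "(tuple s)(i := None)"
  have "(tuple s, Some (\<psi> i), ?q) \<in> transitions (sync I M)"
    unfolding sync_transition_Some
  proof (intro conjI ballI)
    show "?q \<in> PiE I (\<lambda>i. states (M i))"
      using tuple_in_states[OF ne] i(1)
      by (auto simp: PiE_iff extensional_def M_def psi_automaton_simps)
    show "\<psi> i \<in> (\<Union>i\<in>I. alphabet (M i))" using i(1) by (auto simp: alphabet_M)
    fix j assume j: "j \<in> I"
    show "if \<psi> i \<in> alphabet (M j) then (tuple s j, Some (\<psi> i), ?q j) \<in> transitions (M j)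
        else ?q j = tuple s j"
    proof (cases "j = i")
      case True
      then show ?thesis
        using i E_in_states[OF i(1) ne[OF i(1)]]
        by (simp add: tuple_def M_def psi_automaton_simps psi_automaton_transition)
    next
      case False
      then have "\<psi> i \<notin> alphabet (M j)"
        using i(1) j fresh[OF i(1)] inj by (auto simp: alphabet_M dest: inj_onD)
      with False show ?thesis by simp
    qed
  qed (intro tuple_in_states ne)
  then have q: "?q \<in> reachable (sync_marked I M)"
    using tuple_reachable[OF s ne] by (metis reachable_step sync_marked_simps(1))
  have "y \<notin> marked (sync_marked I M)" if "run (sync_marked I M) ?q t y" for t y
  proof -
    \<comment> \<open>\<bottom> is dead, so component \<open>i\<close> never returns to a marked
      state.\<close>
    have "y i = None"
      by (rule run_sync_dead_component[OF that i(1)]) (auto simp: M_def psi_automaton_transition)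
    then show ?thesis
      using i(1) by (force simp: sync_marked_simps M_def psi_automaton_simps PiE_iff)
  qed
  with q show "blocking (sync_marked I M)" by (auto simp: blocking_def)
qed

end

theorem theorem3:
  fixes n :: nat
    and G :: "nat \<Rightarrow> ('q, 'e, 'm) automaton_scheme"
    and QS :: "nat \<Rightarrow> 'q set"
    and \<psi> :: "nat \<Rightarrow> 'e"
  assumes "n \<ge> 1"
    and "\<And>i. i \<in> {1..n} \<Longrightarrow> wf_automaton (G i)"
    and "\<And>i. i \<in> {1..n} \<Longrightarrow> initial (G i) \<noteq> {}"
    and "\<And>i. i \<in> {1..n} \<Longrightarrow> QS i \<subseteq> states (G i)"
    and "inj_on \<psi> {1..n}"
    and "\<And>i. i \<in> {1..n} \<Longrightarrow> \<psi> i \<notin> (\<Union>j\<in>{1..n}. alphabet (G j))"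
  shows "\<not> current_state_opaque (sync {1..n} G) (or_secret {1..n} G QS) \<longleftrightarrow>
         blocking (sync_marked {1..n}
           (\<lambda>i. psi_automaton (det (G i)) {X \<in> states (det (G i)). X \<subseteq> QS i} (\<psi> i)))"
proof -
  interpret psi_composition "{1..n}" G QS \<psi>
    by unfold_locales (use assms in auto)
  show ?thesis
    using not_opaque_sync_iff[of "{1..n}" G QS] blocking_iff_revealing assms(2)
    unfolding M_def[abs_def] by simp
qed

end
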